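(* There is a constant $C$ such that the following holds. Let $n\ge 2$, let $X_1,\dots,X_n$ be independent real random variables with absolutely continuous distributions $F_1,\dots,F_n$, and let $\sigma$ be a uniformly random permutation of $\{1,\dots,n\}$ independent of the prices, with prices presented in the order $X_{\sigma(1)},\dots,X_{\sigma(n)}$. Then there exists a threshold $T$ such that $$\Big(1+\frac{C}{n}\Big)\cdot 2\;\ge\;\frac{\mathbb{E}(\mathrm{OPT})}{\mathbb{E}(\mathrm{ALG}_T)}.$$ The constant $C$ does not depend on the distributions $F_1,\dots,F_n$.
   Context: Trading-prophet problem in random order: there are $n$ periods; in period $i$ the price $X_{\sigma(i)}$ is revealed. An agent starts in period 1 without the item and can hold at most one unit of it. In each period, immediately after observing the price $p$, the agent may buy the item (reward $-p$) if she does not hold it, sell it (reward $+p$) if she holds it, or pass. The profit of an algorithm is its total reward; expectations are over the prices and $\sigma$. $\mathrm{OPT}$ is the maximum total reward over all buy/sell decision sequences given full knowledge of the realized price sequence. For $T\in\mathbb{R}$, $\mathrm{ALG}_T$ is the online algorithm which in each period $i<n$ buys if it does not hold the item and the price is $<T$, sells if it holds the item and the price is $\ge T$, and in period $n$ sells if it holds the item.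
   Formalization: OPT is taken over decision sequences that end without the item (no change for nonnegative prices; with negative prices the claim fails otherwise, e.g. n=2, prices uniform on [-K-1,-K]); prices are assumed integrable so that the ratio is defined. *)

theory Defs
  imports "HOL-Probability.Probability" "HOL-Combinatorics.Permutations"
begin

datatype action = Buy | Sell | Pass

instance action :: finite
proof
  have "(UNIV :: action set) = {Buy, Sell, Pass}"
    using action.exhaust by blast
  then show "finite (UNIV :: action set)"
    by (metis finite.emptyI finite.insertI)
qed

fun reward :: "action \<Rightarrow> real \<Rightarrow> real" where
  "reward Buy p = - p"
| "reward Sell p = p"
| "reward Pass p = 0"

fun held_after :: "bool \<Rightarrow> action \<Rightarrow> bool" where
  "held_after h Buy = True"
| "held_after h Sell = False"
| "held_after h Pass = h"

text \<open>Periods are numbered from 1. The value \<open>holds d i\<close> tells whether the agent has the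
  item at the end of period \<open>i\<close>, so she enters period \<open>i\<close> in state \<open>holds d (i - 1)\<close>.\<close>

primrec holds :: "(nat \<Rightarrow> action) \<Rightarrow> nat \<Rightarrow> bool" where
  "holds d 0 = False"
| "holds d (Suc i) = held_after (holds d i) (d (Suc i))"

text \<open>A decision sequence has to sell every item it buys. Prices may be negative, so without
  \<open>\<not> holds d n\<close> one could gain by buying at a negative price and never selling; for
  nonnegative prices this condition does not change the maximum in \<open>opt\<close> below.\<close>

definition feasible :: "nat \<Rightarrow> (nat \<Rightarrow> action) \<Rightarrow> bool" where
  "feasible n d \<longleftrightarrow> (\<forall>i\<in>{1..n}. (d i = Buy \<longrightarrow> \<not> holds d (i - 1)) \<and> (d i = Sell \<longrightarrow> holds d (i - 1)))
     \<and> \<not> holds d n"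

definition profit :: "nat \<Rightarrow> (nat \<Rightarrow> real) \<Rightarrow> (nat \<Rightarrow> action) \<Rightarrow> real" where
  "profit n p d = (\<Sum>i\<in>{1..n}. reward (d i) (p i))"

text \<open>Decision sequences are extensional functions on the periods, so that there are only
  finitely many of them and \<open>Max\<close> is meaningful.\<close>

definition opt :: "nat \<Rightarrow> (nat \<Rightarrow> real) \<Rightarrow> real" where
  "opt n p = Max {profit n p d | d. d \<in> {1..n} \<rightarrow>\<^sub>E UNIV \<and> feasible n d}"

definition alg_action :: "nat \<Rightarrow> real \<Rightarrow> nat \<Rightarrow> bool \<Rightarrow> real \<Rightarrow> action" where
  "alg_action n T i h x =
     (if i < n then
        (if \<not> h \<and> x < T then Buy else if h \<and> x \<ge> T then Sell else Pass)
      else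
        (if h then Sell else Pass))"

primrec alg_holds :: "nat \<Rightarrow> real \<Rightarrow> (nat \<Rightarrow> real) \<Rightarrow> nat \<Rightarrow> bool" where
  "alg_holds n T p 0 = False"
| "alg_holds n T p (Suc i) =
     held_after (alg_holds n T p i) (alg_action n T (Suc i) (alg_holds n T p i) (p (Suc i)))"

definition alg_decision :: "nat \<Rightarrow> real \<Rightarrow> (nat \<Rightarrow> real) \<Rightarrow> nat \<Rightarrow> action" where
  "alg_decision n T p i = alg_action n T i (alg_holds n T p (i - 1)) (p i)"

definition alg :: "nat \<Rightarrow> real \<Rightarrow> (nat \<Rightarrow> real) \<Rightarrow> real" where
  "alg n T p = profit n p (alg_decision n T p)"

lemma holds_alg_decision: "holds (alg_decision n T p) i = alg_holds n T p i"
  by (induction i) (simp_all add: alg_decision_def)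

lemma feasible_alg_decision: "feasible n (alg_decision n T p)"
  unfolding feasible_def holds_alg_decision
  by (cases n) (simp_all add: alg_decision_def alg_action_def)

lemma finite_opt_profits:
  "finite {profit n p d | d. d \<in> {1..n} \<rightarrow>\<^sub>E UNIV \<and> feasible n d}"
proof -
  have "finite ({1..n} \<rightarrow>\<^sub>E (UNIV :: action set))"
    by (simp add: finite_PiE)
  then have "finite (profit n p ` ({1..n} \<rightarrow>\<^sub>E UNIV))"
    by (rule finite_imageI)
  then show ?thesis
    by (rule rev_finite_subset) blast
qed

definition uniform_random_perm :: "'a measure \<Rightarrow> nat \<Rightarrow> ('a \<Rightarrow> nat \<Rightarrow> nat) \<Rightarrow> bool" where
  "uniform_random_perm M n \<sigma> \<longleftrightarrow>
     \<sigma> \<in> measurable M (count_space {\<pi>. \<pi> permutes {1..n}}) \<and>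
     distr M (count_space {\<pi>. \<pi> permutes {1..n}}) \<sigma> = uniform_count_measure {\<pi>. \<pi> permutes {1..n}}"

text \<open>The constant \<open>indep_var\<close> needs both variables to have the same value type, hence
  independence of the permutation from the price vector is stated for the generated
  \<open>\<sigma>\<close>-algebras.\<close>

definition perm_indep_of_prices ::
  "'a measure \<Rightarrow> nat \<Rightarrow> (nat \<Rightarrow> 'a \<Rightarrow> real) \<Rightarrow> ('a \<Rightarrow> nat \<Rightarrow> nat) \<Rightarrow> bool" where
  "perm_indep_of_prices M n X \<sigma> \<longleftrightarrow>
     prob_space.indep_set M
       (sets (vimage_algebra (space M) \<sigma> (count_space {\<pi>. \<pi> permutes {1..n}})))
       (sets (vimage_algebra (space M) (\<lambda>\<omega>. \<lambda>i\<in>{1..n}. X i \<omega>) (Pi\<^sub>M {1..n} (\<lambda>_. borel))))"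

definition expected_opt ::
  "'a measure \<Rightarrow> nat \<Rightarrow> (nat \<Rightarrow> 'a \<Rightarrow> real) \<Rightarrow> ('a \<Rightarrow> nat \<Rightarrow> nat) \<Rightarrow> real" where
  "expected_opt M n X \<sigma> = (\<integral>\<omega>. opt n (\<lambda>i. X (\<sigma> \<omega> i) \<omega>) \<partial>M)"

definition expected_alg ::
  "'a measure \<Rightarrow> nat \<Rightarrow> (nat \<Rightarrow> 'a \<Rightarrow> real) \<Rightarrow> ('a \<Rightarrow> nat \<Rightarrow> nat) \<Rightarrow> real \<Rightarrow> real" where
  "expected_alg M n X \<sigma> T = (\<integral>\<omega>. alg n T (\<lambda>i. X (\<sigma> \<omega> i) \<omega>) \<partial>M)"

end

theory Submission
  imports Defs
begin

text \<open>
  For every \<open>t\<close>, a feasible decision sequence earns at most \<open>\<Sum>\<^sub>b \<bar>X\<^sub>b - t\<bar>\<close>, since it earns nothing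
  on the constant price \<open>t\<close>. The agent using threshold \<open>T\<close> holds the item after a period \<open>i < n\<close>
  exactly if the price is below \<open>T\<close>, so with \<open>c\<^sub>b = P(X\<^sub>b < T)\<close> and \<open>S = \<Sum>\<^sub>b c\<^sub>b\<close> a random order gives
  \<open>n E(ALG\<^sub>T) = \<Sum>\<^sub>b (S - c\<^sub>b) E(X\<^sub>b - T)\<^sup>+ + (n - 1 - S + c\<^sub>b) E(T - X\<^sub>b)\<^sup>+\<close>.
  By continuity there is \<open>T\<close> with \<open>S = n/2\<close>, and then both coefficients are at least \<open>n/2 - 1\<close>,
  whence \<open>E(ALG\<^sub>T) \<ge> (1/2 - 1/n) \<Sum>\<^sub>b E\<bar>X\<^sub>b - T\<bar>\<close>. This is void for \<open>n = 2\<close>, where instead the better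
  one of the medians of \<open>X\<^sub>1\<close> and \<open>X\<^sub>2\<close> is used as threshold.
\<close>

section \<open>Profits as sums of price increments\<close>

text \<open>Summation by parts: an item earns the increments of the price over the periods at whose
  end it is held. The last term accounts for an item still in hand; it is there for the induction,
  because a prefix of a feasible sequence may end while holding.\<close>

lemma profit_eq_sum_holds:
  assumes "\<forall>i\<in>{1..n}. (d i = Buy \<longrightarrow> \<not> holds d (i - 1)) \<and> (d i = Sell \<longrightarrow> holds d (i - 1))"
  shows "profit n p d =
    (\<Sum>i\<in>{1..<n}. of_bool (holds d i) * (p (Suc i) - p i)) - of_bool (holds d n) * p n"
  using assms
proof (induction n)
  case 0
  then show ?case by (simp add: profit_def)
next
  case (Suc n)
  have IH: "profit n p d =
      (\<Sum>i\<in>{1..<n}. of_bool (holds d i) * (p (Suc i) - p i)) - of_bool (holds d n) * p n"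
    using Suc by simp
  have "reward (d (Suc n)) (p (Suc n)) =
      (of_bool (holds d n) - of_bool (holds d (Suc n))) * p (Suc n)"
    using Suc.prems[rule_format, of "Suc n"] by (cases "d (Suc n)") auto
  then have step: "profit (Suc n) p d = profit n p d
      + (of_bool (holds d n) - of_bool (holds d (Suc n))) * p (Suc n)"
    by (simp add: profit_def)
  show ?case
  proof (cases "n = 0")
    case False
    then show ?thesis
      unfolding step IH by (simp add: algebra_simps)
  qed (use step IH in simp)
qed

lemma profit_feasible:
  assumes "feasible n d"
  shows "profit n p d = (\<Sum>i\<in>{1..<n}. of_bool (holds d i) * (p (Suc i) - p i))"
  using profit_eq_sum_holds[of n d p] assms by (simp add: feasible_def)

lemma opt_le_sum_abs_diff: "opt n p \<le> (\<Sum>i\<in>{1..n}. \<bar>p i - t\<bar>)"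
proof -
  have le: "profit n p d \<le> (\<Sum>i\<in>{1..n}. \<bar>p i - t\<bar>)" if "feasible n d" for d
  proof -
    have "profit n p d - profit n (\<lambda>_. t) d
        = (\<Sum>i\<in>{1..n}. reward (d i) (p i) - reward (d i) t)"
      by (simp add: profit_def sum_subtractf)
    also have "\<dots> \<le> (\<Sum>i\<in>{1..n}. \<bar>p i - t\<bar>)"
    proof (rule sum_mono)
      fix i show "reward (d i) (p i) - reward (d i) t \<le> \<bar>p i - t\<bar>"
        by (cases "d i") auto
    qed
    finally show ?thesis
      using profit_feasible[OF that, of "\<lambda>_. t"] by simp
  qed
  \<comment> \<open>The bound on \<open>Max\<close> requires a nonempty set of profits; never
    trading is a feasible sequence, restricted to the periods to be extensional.\<close>
  have "restrict (\<lambda>_. Pass) {1..n} \<in> {1..n} \<rightarrow>\<^sub>E UNIV" by simp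
  moreover have "\<not> holds (restrict (\<lambda>_. Pass) {1..n}) i" if "i \<le> n" for i
    using that by (induction i) auto
  then have "feasible n (restrict (\<lambda>_. Pass) {1..n})"
    by (auto simp: feasible_def)
  ultimately have "{profit n p d | d. d \<in> {1..n} \<rightarrow>\<^sub>E UNIV \<and> feasible n d} \<noteq> {}"
    by blast
  then show ?thesis
    unfolding opt_def using le finite_opt_profits by (subst Max_le_iff) auto
qed

text \<open>Before the last period the new state depends on the current price alone and not on the
  old state. Hence each summand involves just two consecutive prices, and a random order enters only
  through ordered pairs.\<close>

lemma alg_eq_sum: "alg n T p = (\<Sum>i\<in>{1..<n}. of_bool (p i < T) * (p (Suc i) - p i))"
proof -
  have "alg_holds n T p i \<longleftrightarrow> p i < T" if "i \<in> {1..<n}" for i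
    using that by (cases i) (auto simp: alg_action_def)
  then show ?thesis
    unfolding alg_def profit_feasible[OF feasible_alg_decision] holds_alg_decision
    by (intro sum.cong) auto
qed

section \<open>Averaging over permutations\<close>

lemma permutation_moving_pair:
  assumes "i \<in> S" "j \<in> S" "k \<in> S" "l \<in> S" "i \<noteq> j" "k \<noteq> l"
  obtains q where "q permutes S" "q i = k" "q j = l"
proof
  \<comment> \<open>The right factor acts first. It sends \<open>j\<close> to the preimage of
    \<open>l\<close> under the swap of \<open>i\<close> and \<open>k\<close>, and it fixes
    \<open>i\<close>, since \<open>k \<noteq> l\<close> keeps that preimage different from
    \<open>i\<close>.\<close>
  let ?q = "Transposition.transpose i k \<circ> Transposition.transpose j (Transposition.transpose i k l)"
  have "Transposition.transpose i k l \<in> S"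
    using assms by (auto simp: Transposition.transpose_def)
  then show "?q permutes S"
    using assms by (intro permutes_compose permutes_swap_id)
  show "?q i = k" "?q j = l"
    using assms by (auto simp: Transposition.transpose_def)
qed

text \<open>By double transitivity, the left-hand sum does not depend on the pair \<open>(i, j)\<close>, so it can be
  computed by averaging over all pairs.\<close>
lemma sum_permutations_pair:
  fixes h :: "'b \<Rightarrow> 'b \<Rightarrow> real"
  assumes S: "finite S" and ij: "i \<in> S" "j \<in> S" "i \<noteq> j"
  shows "real (card S) * (real (card S) - 1) * (\<Sum>\<pi> | \<pi> permutes S. h (\<pi> i) (\<pi> j))
    = fact (card S) * (\<Sum>a\<in>S. \<Sum>b\<in>S - {a}. h a b)"
proof -
  let ?G = "\<lambda>i j. \<Sum>\<pi> | \<pi> permutes S. h (\<pi> i) (\<pi> j)"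
  have inv: "?G k l = ?G i j" if kl: "k \<in> S" "l \<in> S - {k}" for k l
  proof -
    obtain q where q: "q permutes S" "q i = k" "q j = l"
      using permutation_moving_pair[of i S j k l] ij kl by auto
    show ?thesis
      using sum_permutations_compose_right[OF q(1), of "\<lambda>\<pi>. h (\<pi> i) (\<pi> j)"] q by (simp add: o_def)
  qed
  have "card S \<ge> 1"
    using S ij by (metis One_nat_def Suc_leI card_gt_0_iff empty_iff)
  then have "(\<Sum>k\<in>S. \<Sum>l\<in>S - {k}. ?G k l) = real (card S) * (real (card S) - 1) * ?G i j"
    by (simp add: inv S)
  moreover have "(\<Sum>k\<in>S. \<Sum>l\<in>S - {k}. ?G k l)
      = (\<Sum>\<pi> | \<pi> permutes S. \<Sum>k\<in>S. \<Sum>l\<in>S - {k}. h (\<pi> k) (\<pi> l))"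
    by (subst sum.swap) (simp add: sum.swap[of _ "S - _"] sum.swap[of _ S])
  moreover have "(\<Sum>k\<in>S. \<Sum>l\<in>S - {k}. h (\<pi> k) (\<pi> l)) = (\<Sum>a\<in>S. \<Sum>b\<in>S - {a}. h a b)"
    if \<pi>: "\<pi> permutes S" for \<pi>
  proof -
    have "(\<Sum>l\<in>S - {k}. h (\<pi> k) (\<pi> l)) = (\<Sum>b\<in>S - {\<pi> k}. h (\<pi> k) b)" if "k \<in> S" for k
    proof -
      have "bij_betw \<pi> (S - {k}) (S - {\<pi> k})"
        using that \<pi> by (intro bij_betw_DiffI permutes_imp_bij) (auto simp: permutes_in_image)
      then show ?thesis
        by (rule sum.reindex_bij_betw)
    qed
    then have "(\<Sum>k\<in>S. \<Sum>l\<in>S - {k}. h (\<pi> k) (\<pi> l)) = (\<Sum>k\<in>S. \<Sum>b\<in>S - {\<pi> k}. h (\<pi> k) b)"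
      by simp
    also have "\<dots> = (\<Sum>a\<in>S. \<Sum>b\<in>S - {a}. h a b)"
      using permutes_imp_bij[OF \<pi>] by (rule sum.reindex_bij_betw)
    finally show ?thesis .
  qed
  ultimately show ?thesis
    using card_permutations[OF refl S] by simp
qed

text \<open>Coefficients are collected for fixed \<open>b\<close>: \<open>u b\<close> is multiplied
  by \<open>c a\<close> for every \<open>a \<noteq> b\<close>, and \<open>v b\<close> by minus the
  same, plus 1 for each of the \<open>card I - 1\<close> pairs that have \<open>b\<close> as first
  component.\<close>

lemma sum_off_diagonal:
  fixes c u v :: "'b \<Rightarrow> real"
  assumes I: "finite I"
  shows "(\<Sum>a\<in>I. \<Sum>b\<in>I - {a}. c a * (u b - v b) + v a)
    = (\<Sum>b\<in>I. (sum c I - c b) * u b + (real (card I) - 1 - sum c I + c b) * v b)"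
proof -
  have "(\<Sum>b\<in>I - {a}. c a * (u b - v b) + v a)
      = c a * (\<Sum>b\<in>I. u b - v b) + real (card I) * v a - (c a * (u a - v a) + v a)" if "a \<in> I" for a
  proof -
    have "card I \<ge> 1"
      using that I by (metis One_nat_def Suc_leI card_gt_0_iff empty_iff)
    with that I show ?thesis
      by (simp add: sum_diff1 sum.distrib sum_subtractf sum_distrib_left of_nat_diff algebra_simps)
  qed
  then have "(\<Sum>a\<in>I. \<Sum>b\<in>I - {a}. c a * (u b - v b) + v a)
      = (\<Sum>a\<in>I. c a * (\<Sum>b\<in>I. u b - v b) + real (card I) * v a - (c a * (u a - v a) + v a))"
    by simp
  also have "\<dots> = sum c I * (\<Sum>b\<in>I. u b - v b)
      + (\<Sum>a\<in>I. real (card I) * v a - (c a * (u a - v a) + v a))"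
    by (simp add: sum.distrib sum_subtractf sum_distrib_right algebra_simps)
  also have "\<dots> = (\<Sum>b\<in>I. (sum c I - c b) * u b + (real (card I) - 1 - sum c I + c b) * v b)"
    unfolding sum_distrib_left[of "sum c I"] sum.distrib[symmetric]
    by (intro sum.cong) (simp_all add: algebra_simps)
  finally show ?thesis .
qed

section \<open>Independence and the random order\<close>

context prob_space
begin

lemma indep_vars_imp_indep_var:
  assumes "indep_vars N X I" "a \<in> I" "b \<in> I" "a \<noteq> b"
  shows "indep_var (N a) (X a) (N b) (X b)"
proof -
  have "indep_var (PiM {a} N) (\<lambda>\<omega>. restrict (\<lambda>i. X i \<omega>) {a}) (PiM {b} N) (\<lambda>\<omega>. restrict (\<lambda>i. X i \<omega>) {b})"
    using assms by (intro indep_var_restrict) auto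
  then have "indep_var (N a) ((\<lambda>v. v a) \<circ> (\<lambda>\<omega>. restrict (\<lambda>i. X i \<omega>) {a}))
      (N b) ((\<lambda>v. v b) \<circ> (\<lambda>\<omega>. restrict (\<lambda>i. X i \<omega>) {b}))"
    by (rule indep_var_compose) auto
  then show ?thesis by (simp add: o_def)
qed

text \<open>Leads from independence of generated \<sigma>-algebras, the form used in
  \<open>perm_indep_of_prices\<close>, to the product rule for expectations. An event is represented
  by its real-valued indicator, so that \<open>indep_var\<close> becomes applicable.\<close>

lemma indep_set_indicator_integral:
  fixes g :: "'b \<Rightarrow> real"
  assumes ind: "indep_set \<A> (sets (vimage_algebra (space M) V N))" and A: "A \<in> \<A>"
    and V: "V \<in> measurable M N"
    and g: "g \<in> borel_measurable N" "integrable M (\<lambda>\<omega>. g (V \<omega>))"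
  shows "integrable M (\<lambda>\<omega>. indicat_real A \<omega> * g (V \<omega>))"
    and "(\<integral>\<omega>. indicat_real A \<omega> * g (V \<omega>) \<partial>M) = prob A * (\<integral>\<omega>. g (V \<omega>) \<partial>M)"
proof -
  have ev: "A \<in> events"
    using ind A indep_setD_ev1 by blast
  \<comment> \<open>Independence is first shown for intersection-stable generators and then extended
    to the \<sigma>-algebras they generate.\<close>
  have "indep_set {A} {(\<lambda>\<omega>. g (V \<omega>)) -` B \<inter> space M | B. B \<in> sets borel}"
    unfolding indep_sets2_eq
  proof (intro conjI ballI)
    show "{A} \<subseteq> events" using ev by simp
    show "{(\<lambda>\<omega>. g (V \<omega>)) -` B \<inter> space M |B. B \<in> sets borel} \<subseteq> events"
      using g(2) by auto
    fix A' B' assume "A' \<in> {A}" "B' \<in> {(\<lambda>\<omega>. g (V \<omega>)) -` B \<inter> space M |B. B \<in> sets borel}"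
    then obtain B where B: "A' = A" "B' = (\<lambda>\<omega>. g (V \<omega>)) -` B \<inter> space M" "B \<in> sets borel" by auto
    have "B' = V -` (g -` B \<inter> space N) \<inter> space M"
      using B(2) measurable_space[OF V] by auto
    moreover have "g -` B \<inter> space N \<in> sets N"
      using g(1) B(3) by (rule measurable_sets)
    ultimately have "B' \<in> sets (vimage_algebra (space M) V N)"
      by (simp only: in_vimage_algebra)
    then show "prob (A' \<inter> B') = prob A' * prob B'"
      using indep_setD[OF ind A] B(1) by simp
  qed
  then have "indep_set (sigma_sets (space M) {A})
      (sigma_sets (space M) {(\<lambda>\<omega>. g (V \<omega>)) -` B \<inter> space M | B. B \<in> sets borel})"
  proof (rule indep_set_sigma_sets)
    show "Int_stable {(\<lambda>\<omega>. g (V \<omega>)) -` B \<inter> space M | B. B \<in> sets borel}"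
    proof (rule Int_stableI)
      fix a b assume "a \<in> {(\<lambda>\<omega>. g (V \<omega>)) -` B \<inter> space M | B. B \<in> sets borel}"
        "b \<in> {(\<lambda>\<omega>. g (V \<omega>)) -` B \<inter> space M | B. B \<in> sets borel}"
      then obtain B C where "a = (\<lambda>\<omega>. g (V \<omega>)) -` B \<inter> space M" "B \<in> sets borel"
        "b = (\<lambda>\<omega>. g (V \<omega>)) -` C \<inter> space M" "C \<in> sets borel" by auto
      then show "a \<inter> b \<in> {(\<lambda>\<omega>. g (V \<omega>)) -` B \<inter> space M | B. B \<in> sets borel}"
        by (intro CollectI exI[of _ "B \<inter> C"]) auto
    qed
  qed (auto simp: Int_stable_def)
  \<comment> \<open>A preimage under the indicator is empty, \<open>A\<close>, the complement of
    \<open>A\<close>, or the whole space.\<close>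
  moreover have "sigma_sets (space M) {indicat_real A -` B \<inter> space M | B. B \<in> sets borel}
      \<subseteq> sigma_sets (space M) {A}"
  proof (rule sigma_sets_mono, safe)
    fix B :: "real set"
    interpret S: sigma_algebra "space M" "sigma_sets (space M) {A}"
      by (rule sigma_algebra_sigma_sets) (use sets.sets_into_space[OF ev] in auto)
    have "A \<in> sigma_sets (space M) {A}" by auto
    moreover have "A \<subseteq> space M" using ev by (rule sets.sets_into_space)
    then have "indicat_real A -` B \<inter> space M =
        (if 1 \<in> B then A else {}) \<union> (if 0 \<in> B then space M - A else {})"
      by (auto simp: indicator_def of_bool_def split: if_splits)
    ultimately show "indicat_real A -` B \<inter> space M \<in> sigma_sets (space M) {A}"
      by auto
  qed
  ultimately have "indep_set (sigma_sets (space M) {indicat_real A -` B \<inter> space M | B. B \<in> sets borel})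
      (sigma_sets (space M) {(\<lambda>\<omega>. g (V \<omega>)) -` B \<inter> space M | B. B \<in> sets borel})"
    unfolding indep_sets2_eq by (meson subset_iff)
  then have "indep_var borel (indicat_real A) borel (\<lambda>\<omega>. g (V \<omega>))"
    using ev g(2) by (auto simp: indep_var_eq)
  moreover have "integrable M (indicat_real A)"
    using ev by (simp add: emeasure_eq_measure)
  ultimately show "integrable M (\<lambda>\<omega>. indicat_real A \<omega> * g (V \<omega>))"
    "(\<integral>\<omega>. indicat_real A \<omega> * g (V \<omega>) \<partial>M) = prob A * (\<integral>\<omega>. g (V \<omega>) \<partial>M)"
    using g(2) ev by (auto simp: indep_var_integrable indep_var_lebesgue_integral)
qed

text \<open>Splitting by the value of \<open>\<sigma>\<close> writes the integrand as a finite sum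
  of indicators times functions of the prices alone. By independence and uniformity each summand
  gets the weight \<open>1 / fact n\<close>. The restricted vector \<open>V\<close> is the one for
  which independence is assumed.\<close>

lemma expectation_random_perm:
  fixes g :: "(nat \<Rightarrow> nat) \<Rightarrow> (nat \<Rightarrow> real) \<Rightarrow> real" and X :: "nat \<Rightarrow> 'a \<Rightarrow> real" and n :: nat
  defines "V \<equiv> \<lambda>\<omega>. \<lambda>i\<in>{1..n}. X i \<omega>"
  assumes unif: "uniform_random_perm M n \<sigma>" and ind: "perm_indep_of_prices M n X \<sigma>"
    and X: "\<And>i. i \<in> {1..n} \<Longrightarrow> random_variable borel (X i)"
    and g: "\<And>\<pi>. \<pi> permutes {1..n} \<Longrightarrow> g \<pi> \<in> borel_measurable (PiM {1..n} (\<lambda>_. borel))"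
      "\<And>\<pi>. \<pi> permutes {1..n} \<Longrightarrow> integrable M (\<lambda>\<omega>. g \<pi> (V \<omega>))"
  shows "(\<integral>\<omega>. g (\<sigma> \<omega>) (V \<omega>) \<partial>M)
    = (\<Sum>\<pi> | \<pi> permutes {1..n}. \<integral>\<omega>. g \<pi> (V \<omega>) \<partial>M) / fact n"
proof -
  let ?P = "{\<pi>. \<pi> permutes {1..n}}"
  let ?A = "\<lambda>\<pi>. \<sigma> -` {\<pi>} \<inter> space M"
  have P: "finite ?P" "card ?P = fact n"
    by (simp_all add: finite_permutations card_permutations)
  have \<sigma>: "\<sigma> \<in> measurable M (count_space ?P)"
    "distr M (count_space ?P) \<sigma> = uniform_count_measure ?P"
    using unif by (auto simp: uniform_random_perm_def)
  have prob: "prob (?A \<pi>) = 1 / fact n" if "\<pi> \<in> ?P" for \<pi>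
  proof -
    have "prob (?A \<pi>) = measure (distr M (count_space ?P) \<sigma>) {\<pi>}"
      using that \<sigma>(1) by (subst measure_distr) auto
    also have "\<dots> = 1 / fact n"
      using that P unfolding \<sigma>(2) by (subst measure_uniform_count_measure) auto
    finally show ?thesis .
  qed
  have V: "V \<in> measurable M (PiM {1..n} (\<lambda>_. borel))"
    unfolding V_def using X by (intro measurable_restrict) auto
  have A: "?A \<pi> \<in> sets (vimage_algebra (space M) \<sigma> (count_space ?P))" if "\<pi> \<in> ?P" for \<pi>
    using that by (intro in_vimage_algebra) auto
  note I = indep_set_indicator_integral[OF ind[unfolded perm_indep_of_prices_def, folded V_def] A V]
  have "g (\<sigma> \<omega>) (V \<omega>) = (\<Sum>\<pi>\<in>?P. indicat_real (?A \<pi>) \<omega> * g \<pi> (V \<omega>))" if "\<omega> \<in> space M" for \<omega>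
  proof -
    have "\<sigma> \<omega> \<in> ?P"
      using measurable_space[OF \<sigma>(1) that] by simp
    then have "(\<Sum>\<pi>\<in>?P. indicat_real (?A \<pi>) \<omega> * g \<pi> (V \<omega>))
        = (\<Sum>\<pi>\<in>?P. if \<pi> = \<sigma> \<omega> then g \<pi> (V \<omega>) else 0)"
      using that by (intro sum.cong) (auto simp: indicator_def)
    then show ?thesis
      using \<open>\<sigma> \<omega> \<in> ?P\<close> P(1) by simp
  qed
  then have "(\<integral>\<omega>. g (\<sigma> \<omega>) (V \<omega>) \<partial>M)
      = (\<integral>\<omega>. (\<Sum>\<pi>\<in>?P. indicat_real (?A \<pi>) \<omega> * g \<pi> (V \<omega>)) \<partial>M)"
    by (intro Bochner_Integration.integral_cong) auto
  also have "\<dots> = (\<Sum>\<pi>\<in>?P. prob (?A \<pi>) * (\<integral>\<omega>. g \<pi> (V \<omega>) \<partial>M))"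
    using I g by (subst Bochner_Integration.integral_sum) auto
  also have "\<dots> = (\<Sum>\<pi>\<in>?P. (\<integral>\<omega>. g \<pi> (V \<omega>) \<partial>M)) / fact n"
    by (simp add: prob sum_divide_distrib)
  finally show ?thesis .
qed

section \<open>Expected profit of the threshold agent\<close>

text \<open>Split \<open>Z - Y\<close> as \<open>(Z - T) + (T - Y)\<close>. On the event
  \<open>Y < T\<close> the second part is the positive part of \<open>T - Y\<close>; the first part
  is independent of this event, so its expectation factors.\<close>

lemma integral_buy_below:
  fixes Y Z :: "'a \<Rightarrow> real"
  assumes ind: "indep_var borel Y borel Z" and int: "integrable M Y" "integrable M Z"
  shows "integrable M (\<lambda>\<omega>. of_bool (Y \<omega> < T) * (Z \<omega> - Y \<omega>))"
    and "(\<integral>\<omega>. of_bool (Y \<omega> < T) * (Z \<omega> - Y \<omega>) \<partial>M)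
    = prob {\<omega> \<in> space M. Y \<omega> < T} * ((\<integral>\<omega>. max 0 (Z \<omega> - T) \<partial>M) - (\<integral>\<omega>. max 0 (T - Z \<omega>) \<partial>M))
      + (\<integral>\<omega>. max 0 (T - Y \<omega>) \<partial>M)"
proof -
  have [measurable]: "random_variable borel Y" "random_variable borel Z"
    using int by auto
  let ?c = "\<lambda>\<omega>. of_bool (Y \<omega> < T) :: real"
  have c: "?c = indicat_real {\<omega>. Y \<omega> < T}" by (auto simp: indicator_def fun_eq_iff)
  have c_int: "integrable M ?c"
    by (rule integrable_const_bound[where B = 1]) auto
  have c_eq: "(\<integral>\<omega>. ?c \<omega> \<partial>M) = prob {\<omega> \<in> space M. Y \<omega> < T}"
    unfolding c by (simp add: Int_def conj_commute)
  have ind': "indep_var borel ?c borel (\<lambda>\<omega>. Z \<omega> - T)"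
    using indep_var_compose[OF ind, of "\<lambda>y. of_bool (y < T) :: real" borel "\<lambda>z. z - T" borel]
    by (simp add: o_def)
  have Zint: "integrable M (\<lambda>\<omega>. Z \<omega> - T)" using int by simp
  have pos: "integrable M (\<lambda>\<omega>. max 0 (Z \<omega> - T))" "integrable M (\<lambda>\<omega>. max 0 (T - Z \<omega>))"
    "integrable M (\<lambda>\<omega>. max 0 (T - Y \<omega>))" using int by auto
  have eq: "?c \<omega> * (Z \<omega> - Y \<omega>) = ?c \<omega> * (Z \<omega> - T) + max 0 (T - Y \<omega>)" for \<omega>
    by (auto simp: max_def)
  have prod: "integrable M (\<lambda>\<omega>. ?c \<omega> * (Z \<omega> - T))"
    by (rule indep_var_integrable[OF ind' c_int Zint])
  show "integrable M (\<lambda>\<omega>. ?c \<omega> * (Z \<omega> - Y \<omega>))"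
    unfolding eq using prod pos by auto
  have "(\<integral>\<omega>. Z \<omega> - T \<partial>M) = (\<integral>\<omega>. max 0 (Z \<omega> - T) - max 0 (T - Z \<omega>) \<partial>M)"
    by (rule Bochner_Integration.integral_cong) (auto simp: max_def)
  also have "\<dots> = (\<integral>\<omega>. max 0 (Z \<omega> - T) \<partial>M) - (\<integral>\<omega>. max 0 (T - Z \<omega>) \<partial>M)"
    using pos by simp
  finally show "(\<integral>\<omega>. ?c \<omega> * (Z \<omega> - Y \<omega>) \<partial>M)
    = prob {\<omega> \<in> space M. Y \<omega> < T} * ((\<integral>\<omega>. max 0 (Z \<omega> - T) \<partial>M) - (\<integral>\<omega>. max 0 (T - Z \<omega>) \<partial>M))
      + (\<integral>\<omega>. max 0 (T - Y \<omega>) \<partial>M)"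
    unfolding eq using prod pos indep_var_lebesgue_integral[OF ind' c_int Zint] c_eq by simp
qed

text \<open>Each of the \<open>n - 1\<close> pairs of consecutive periods shows a uniformly random
  ordered pair of distinct indices. The profit is therefore \<open>n - 1\<close> times an average
  over \<open>n * (n - 1)\<close> pairs, and cancelling \<open>n - 1\<close> leaves the off-diagonal
  sum divided by \<open>n\<close>.\<close>

lemma expected_alg_eq:
  fixes X :: "nat \<Rightarrow> 'a \<Rightarrow> real" and n :: nat and T :: real
  defines "c \<equiv> \<lambda>b. prob {\<omega> \<in> space M. X b \<omega> < T}"
    and "u \<equiv> \<lambda>b. \<integral>\<omega>. max 0 (X b \<omega> - T) \<partial>M"
    and "v \<equiv> \<lambda>b. \<integral>\<omega>. max 0 (T - X b \<omega>) \<partial>M"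
  assumes n: "n \<ge> 2" and X: "indep_vars (\<lambda>_. borel) X {1..n}"
    and int: "\<And>i. i \<in> {1..n} \<Longrightarrow> integrable M (X i)"
    and unif: "uniform_random_perm M n \<sigma>" and ind: "perm_indep_of_prices M n X \<sigma>"
  shows "real n * expected_alg M n X \<sigma> T
    = (\<Sum>b\<in>{1..n}. (sum c {1..n} - c b) * u b + (real n - 1 - sum c {1..n} + c b) * v b)"
proof -
  \<comment> \<open>The expected contribution of two consecutive periods showing \<open>X a\<close>
    and then \<open>X b\<close>.\<close>
  define h where "h \<equiv> \<lambda>a b. c a * (u b - v b) + v a"
  define g :: "(nat \<Rightarrow> nat) \<Rightarrow> (nat \<Rightarrow> real) \<Rightarrow> real"
    where "g \<equiv> \<lambda>\<pi> w. \<Sum>i\<in>{1..<n}. of_bool (w (\<pi> i) < T) * (w (\<pi> (Suc i)) - w (\<pi> i))"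
  let ?V = "\<lambda>\<omega>. \<lambda>i\<in>{1..n}. X i \<omega>"
  let ?H = "\<Sum>a\<in>{1..n}. \<Sum>b\<in>{1..n} - {a}. h a b"
  have in_range: "\<pi> i \<in> {1..n} \<and> \<pi> (Suc i) \<in> {1..n} \<and> \<pi> i \<noteq> \<pi> (Suc i)"
    if "\<pi> permutes {1..n}" "i \<in> {1..<n}" for \<pi> i
    using that permutes_inj[OF that(1)] permutes_in_image[OF that(1)] by (auto dest: injD)
  have g_V: "g \<pi> (?V \<omega>)
      = (\<Sum>i\<in>{1..<n}. of_bool (X (\<pi> i) \<omega> < T) * (X (\<pi> (Suc i)) \<omega> - X (\<pi> i) \<omega>))"
    if "\<pi> permutes {1..n}" for \<pi> \<omega>
    unfolding g_def using in_range[OF that] by (intro sum.cong) auto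
  have pair: "integrable M (\<lambda>\<omega>. of_bool (X a \<omega> < T) * (X b \<omega> - X a \<omega>))"
    "(\<integral>\<omega>. of_bool (X a \<omega> < T) * (X b \<omega> - X a \<omega>) \<partial>M) = h a b"
    if "a \<in> {1..n}" "b \<in> {1..n}" "a \<noteq> b" for a b
    using integral_buy_below[OF indep_vars_imp_indep_var[OF X that] int[OF that(1)] int[OF that(2)], of T]
    by (auto simp: h_def c_def u_def v_def)
  have g_int: "integrable M (\<lambda>\<omega>. g \<pi> (?V \<omega>))"
    "(\<integral>\<omega>. g \<pi> (?V \<omega>) \<partial>M) = (\<Sum>i\<in>{1..<n}. h (\<pi> i) (\<pi> (Suc i)))"
    if "\<pi> permutes {1..n}" for \<pi>
  proof -
    have i: "integrable M (\<lambda>\<omega>. of_bool (X (\<pi> i) \<omega> < T) * (X (\<pi> (Suc i)) \<omega> - X (\<pi> i) \<omega>))"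
      if "i \<in> {1..<n}" for i
      using pair(1) in_range[OF \<open>\<pi> permutes {1..n}\<close> that] by blast
    then show "integrable M (\<lambda>\<omega>. g \<pi> (?V \<omega>))"
      unfolding g_V[OF that] by (rule Bochner_Integration.integrable_sum)
    have "(\<integral>\<omega>. g \<pi> (?V \<omega>) \<partial>M) = (\<Sum>i\<in>{1..<n}.
        \<integral>\<omega>. of_bool (X (\<pi> i) \<omega> < T) * (X (\<pi> (Suc i)) \<omega> - X (\<pi> i) \<omega>) \<partial>M)"
      unfolding g_V[OF that] using i by (rule Bochner_Integration.integral_sum)
    also have "\<dots> = (\<Sum>i\<in>{1..<n}. h (\<pi> i) (\<pi> (Suc i)))"
      using in_range[OF that] by (intro sum.cong pair(2)) auto
    finally show "(\<integral>\<omega>. g \<pi> (?V \<omega>) \<partial>M) = (\<Sum>i\<in>{1..<n}. h (\<pi> i) (\<pi> (Suc i)))" .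
  qed
  have g_meas: "g \<pi> \<in> borel_measurable (PiM {1..n} (\<lambda>_. borel))" if "\<pi> permutes {1..n}" for \<pi>
  proof -
    have "(\<lambda>w. of_bool (w (\<pi> i) < T) * (w (\<pi> (Suc i)) - w (\<pi> i)))
        \<in> borel_measurable (PiM {1..n} (\<lambda>_. borel :: real measure))" if i: "i \<in> {1..<n}" for i
    proof -
      have [measurable]: "(\<lambda>w. w (\<pi> i)) \<in> borel_measurable (PiM {1..n} (\<lambda>_. borel :: real measure))"
        "(\<lambda>w. w (\<pi> (Suc i))) \<in> borel_measurable (PiM {1..n} (\<lambda>_. borel :: real measure))"
        using in_range[OF \<open>\<pi> permutes {1..n}\<close> i]
        by (auto intro!: measurable_component_singleton)
      show ?thesis by measurable
    qed
    then show ?thesis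
      unfolding g_def by (rule borel_measurable_sum)
  qed
  have rv: "random_variable borel (X i)" if "i \<in> {1..n}" for i
    using int[OF that] by auto
  have perm: "\<sigma> \<omega> permutes {1..n}" if "\<omega> \<in> space M" for \<omega>
    using unif that by (auto simp: uniform_random_perm_def dest: measurable_space)
  have "expected_alg M n X \<sigma> T = (\<integral>\<omega>. g (\<sigma> \<omega>) (?V \<omega>) \<partial>M)"
    unfolding expected_alg_def alg_eq_sum
    by (rule Bochner_Integration.integral_cong) (simp_all only: g_V[OF perm])
  also have "\<dots> = (\<Sum>\<pi> | \<pi> permutes {1..n}. \<integral>\<omega>. g \<pi> (?V \<omega>) \<partial>M) / fact n"
    by (rule expectation_random_perm[OF unif ind rv g_meas g_int(1)])
  also have "\<dots> = (\<Sum>i\<in>{1..<n}. \<Sum>\<pi> | \<pi> permutes {1..n}. h (\<pi> i) (\<pi> (Suc i))) / fact n"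
    by (subst sum.swap) (intro arg_cong2[where f = "(/)"] refl sum.cong g_int(2), simp)
  finally have "(real n * (real n - 1)) * (fact n * expected_alg M n X \<sigma> T)
      = (\<Sum>i\<in>{1..<n}. real n * (real n - 1) * (\<Sum>\<pi> | \<pi> permutes {1..n}. h (\<pi> i) (\<pi> (Suc i))))"
    by (simp add: sum_distrib_left[symmetric])
  also have "\<dots> = (\<Sum>i\<in>{1..<n}. fact n * ?H)"
    using sum_permutations_pair[of "{1..n}" _ _ h] by (intro sum.cong) auto
  also have "\<dots> = (real n - 1) * (fact n * ?H)"
    using n by (simp add: of_nat_diff)
  finally have "real n * expected_alg M n X \<sigma> T = ?H"
    using n by simp
  also have "\<dots> = (\<Sum>b\<in>{1..n}. (sum c {1..n} - c b) * u b + (real n - 1 - sum c {1..n} + c b) * v b)"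
    unfolding h_def by (subst sum_off_diagonal) auto
  finally show ?thesis .
qed

section \<open>Upper bound on the expected optimum\<close>

lemma expected_opt_le:
  assumes int: "\<And>i. i \<in> {1..n} \<Longrightarrow> integrable M (X i)" and unif: "uniform_random_perm M n \<sigma>"
  shows "expected_opt M n X \<sigma> \<le> (\<Sum>b\<in>{1..n}. \<integral>\<omega>. \<bar>X b \<omega> - T\<bar> \<partial>M)"
proof -
  have "opt n (\<lambda>i. X (\<sigma> \<omega> i) \<omega>) \<le> (\<Sum>b\<in>{1..n}. \<bar>X b \<omega> - T\<bar>)" if "\<omega> \<in> space M" for \<omega>
  proof -
    have perm: "\<sigma> \<omega> permutes {1..n}"
      using unif that by (auto simp: uniform_random_perm_def dest: measurable_space)
    have "opt n (\<lambda>i. X (\<sigma> \<omega> i) \<omega>) \<le> (\<Sum>i\<in>{1..n}. \<bar>X (\<sigma> \<omega> i) \<omega> - T\<bar>)"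
      by (rule opt_le_sum_abs_diff)
    also have "\<dots> = (\<Sum>b\<in>{1..n}. \<bar>X b \<omega> - T\<bar>)"
      by (rule sum.reindex_bij_betw[OF permutes_imp_bij[OF perm]])
    finally show ?thesis .
  qed
  \<comment> \<open>\<open>integral_mono'\<close> asks for integrability of the nonnegative upper
    bound only: a non-integrable left-hand side would have integral 0 by convention.\<close>
  then have "expected_opt M n X \<sigma> \<le> (\<integral>\<omega>. (\<Sum>b\<in>{1..n}. \<bar>X b \<omega> - T\<bar>) \<partial>M)"
    unfolding expected_opt_def using int
    by (intro integral_mono' Bochner_Integration.integrable_sum) (auto intro: sum_nonneg)
  also have "\<dots> = (\<Sum>b\<in>{1..n}. \<integral>\<omega>. \<bar>X b \<omega> - T\<bar> \<partial>M)"
    using int by (intro Bochner_Integration.integral_sum) auto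
  finally show ?thesis .
qed

section \<open>Atomless distributions and medians\<close>

lemma abs_continuous_prob_eq_0:
  assumes "random_variable borel X" "absolutely_continuous lborel (distr M borel X)"
  shows "prob {\<omega> \<in> space M. X \<omega> = x} = 0"
proof -
  have "{x} \<in> null_sets lborel" by (simp add: null_sets_def)
  then have "{x} \<in> null_sets (distr M borel X)"
    using assms(2) by (auto simp: absolutely_continuous_def)
  then have "measure (distr M borel X) {x} = 0"
    by (auto simp: null_sets_def measure_def)
  then show ?thesis
    using assms(1) by (simp add: measure_distr vimage_def Int_def conj_commute)
qed

text \<open>Without atoms the sum of the distribution functions is continuous, with limits 0 and
  \<open>card I\<close>, so the intermediate value theorem applies. It yields the balancing
  threshold for \<open>I = {1..n}\<close> and medians for singletons.\<close>

lemma exists_sum_prob_less: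
  fixes X :: "'i \<Rightarrow> 'a \<Rightarrow> real"
  assumes rv: "\<And>i. i \<in> I \<Longrightarrow> random_variable borel (X i)"
    and no_atom: "\<And>i x. i \<in> I \<Longrightarrow> prob {\<omega> \<in> space M. X i \<omega> = x} = 0"
    and r: "0 < r" "r < real (card I)"
  shows "\<exists>T. (\<Sum>i\<in>I. prob {\<omega> \<in> space M. X i \<omega> < T}) = r"
proof -
  define F where "F = (\<lambda>t. \<Sum>i\<in>I. cdf (distr M borel (X i)) t)"
  \<comment> \<open>The agent compares strictly while \<open>cdf\<close> does not; the difference is
    the mass of an atom.\<close>
  have cdf: "cdf (distr M borel (X i)) t = prob {\<omega> \<in> space M. X i \<omega> < t}" if i: "i \<in> I" for i t
  proof -
    have [measurable]: "random_variable borel (X i)" using rv i .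
    have "cdf (distr M borel (X i)) t = prob {\<omega> \<in> space M. X i \<omega> \<le> t}"
      by (simp add: cdf_def measure_distr vimage_def Int_def conj_commute)
    also have "{\<omega> \<in> space M. X i \<omega> \<le> t} = {\<omega> \<in> space M. X i \<omega> < t} \<union> {\<omega> \<in> space M. X i \<omega> = t}"
      by auto
    also have "prob \<dots> = prob {\<omega> \<in> space M. X i \<omega> < t} + prob {\<omega> \<in> space M. X i \<omega> = t}"
      by (rule finite_measure_Union) auto
    finally show ?thesis using no_atom[OF i] by simp
  qed
  have dist: "real_distribution (distr M borel (X i))" if "i \<in> I" for i
    using rv that by simp
  have cont: "isCont F t" for t
    unfolding F_def
  proof (intro isCont_sum ballI)
    fix i assume i: "i \<in> I"
    then interpret D: real_distribution "distr M borel (X i)" by (rule dist)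
    have "measure (distr M borel (X i)) {t} = 0"
      using no_atom[OF i, of t] rv[OF i] by (simp add: measure_distr vimage_def Int_def conj_commute)
    then show "isCont (cdf (distr M borel (X i))) t"
      by (simp add: D.isCont_cdf)
  qed
  have "(F \<longlongrightarrow> (\<Sum>i\<in>I. 0)) at_bot"
    unfolding F_def using dist
    by (intro tendsto_sum finite_borel_measure.cdf_lim_at_bot real_distribution.finite_borel_measure_M)
  then have "eventually (\<lambda>t. F t < r) at_bot"
    using r by (intro order_tendstoD) auto
  then obtain a where a: "F t < r" if "t \<le> a" for t
    by (auto simp: eventually_at_bot_linorder)
  have "(F \<longlongrightarrow> (\<Sum>i\<in>I. 1)) at_top"
    unfolding F_def using dist by (intro tendsto_sum real_distribution.cdf_lim_at_top_prob)
  then have "eventually (\<lambda>t. r < F t) at_top"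
    using r by (intro order_tendstoD) auto
  then obtain b where b: "r < F t" if "t \<ge> b" for t
    by (auto simp: eventually_at_top_linorder)
  have "\<exists>T. a \<le> T \<and> T \<le> max a b \<and> F T = r"
    using a[of a] b[of "max a b"] cont by (intro IVT) auto
  then show ?thesis
    unfolding F_def using cdf by auto
qed

text \<open>A vanishing integral would put all mass at \<open>t\<close>. Strict positivity is what
  later makes the expected profit of the agent positive, so that the ratio is meaningful.\<close>

lemma integral_abs_diff_pos:
  fixes X :: "'a \<Rightarrow> real"
  assumes int: "integrable M X" and no_atom: "prob {\<omega> \<in> space M. X \<omega> = t} = 0"
  shows "(\<integral>\<omega>. \<bar>X \<omega> - t\<bar> \<partial>M) > 0"
proof -
  have [measurable]: "random_variable borel X" using int by auto
  have "(\<integral>\<omega>. \<bar>X \<omega> - t\<bar> \<partial>M) \<noteq> 0"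
  proof
    assume "(\<integral>\<omega>. \<bar>X \<omega> - t\<bar> \<partial>M) = 0"
    then have "AE \<omega> in M. \<bar>X \<omega> - t\<bar> = 0"
      using int by (subst (asm) integral_nonneg_eq_0_iff_AE) auto
    then have "prob {\<omega> \<in> space M. X \<omega> = t} = 1"
      by (subst prob_Collect_eq_1) auto
    with no_atom show False by simp
  qed
  moreover have "(\<integral>\<omega>. \<bar>X \<omega> - t\<bar> \<partial>M) \<ge> 0" by simp
  ultimately show ?thesis by linarith
qed

lemma median_minimizes_abs_diff:
  fixes X :: "'a \<Rightarrow> real"
  assumes int: "integrable M X" and med: "prob {\<omega> \<in> space M. X \<omega> < m} = 1/2"
  shows "(\<integral>\<omega>. \<bar>X \<omega> - m\<bar> \<partial>M) \<le> (\<integral>\<omega>. \<bar>X \<omega> - t\<bar> \<partial>M)"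
proof -
  have [measurable]: "random_variable borel X" using int by auto
  define c where "c = (\<lambda>\<omega>. indicat_real {\<omega> \<in> space M. X \<omega> < m} \<omega>)"
  have c: "integrable M c" "(\<integral>\<omega>. c \<omega> \<partial>M) = 1/2"
    unfolding c_def using med by (auto simp: emeasure_eq_measure)
  \<comment> \<open>The added term has mean 0 because \<open>m\<close> is a median. With it the
    integrand is \<open>t - X\<close> where \<open>X < m\<close> and \<open>X - t\<close> elsewhere,
    hence at most \<open>\<bar>X - t\<bar>\<close>.\<close>
  have "(\<integral>\<omega>. \<bar>X \<omega> - m\<bar> \<partial>M) = (\<integral>\<omega>. \<bar>X \<omega> - m\<bar> + (m - t) * (1 - 2 * c \<omega>) \<partial>M)"
    using int c by (simp add: prob_space)
  also have "\<dots> \<le> (\<integral>\<omega>. \<bar>X \<omega> - t\<bar> \<partial>M)"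
    using int c by (intro integral_mono) (auto simp: c_def indicator_def)
  finally show ?thesis .
qed

lemma integral_pos_part_add_neg_part:
  fixes X :: "'a \<Rightarrow> real"
  assumes "integrable M X"
  shows "(\<integral>\<omega>. max 0 (X \<omega> - t) \<partial>M) + (\<integral>\<omega>. max 0 (t - X \<omega>) \<partial>M) = (\<integral>\<omega>. \<bar>X \<omega> - t\<bar> \<partial>M)"
proof -
  have "(\<integral>\<omega>. max 0 (X \<omega> - t) + max 0 (t - X \<omega>) \<partial>M) = (\<integral>\<omega>. \<bar>X \<omega> - t\<bar> \<partial>M)"
    by (rule Bochner_Integration.integral_cong) (auto simp: max_def)
  then show ?thesis using assms by simp
qed

section \<open>Choice of the threshold\<close>

lemma exists_threshold:
  fixes X :: "nat \<Rightarrow> 'a \<Rightarrow> real"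
  assumes n: "n \<ge> 2" and X: "indep_vars (\<lambda>_. borel) X {1..n}"
    and ac: "\<And>i. i \<in> {1..n} \<Longrightarrow> absolutely_continuous lborel (distr M borel (X i))"
    and int: "\<And>i. i \<in> {1..n} \<Longrightarrow> integrable M (X i)"
    and unif: "uniform_random_perm M n \<sigma>" and ind: "perm_indep_of_prices M n X \<sigma>"
  shows "\<exists>T. expected_alg M n X \<sigma> T > 0 \<and>
    expected_opt M n X \<sigma> \<le> (1 + 6 / real n) * 2 * expected_alg M n X \<sigma> T"
proof -
  let ?A = "expected_alg M n X \<sigma>" and ?O = "expected_opt M n X \<sigma>"
  define c where "c = (\<lambda>T b. prob {\<omega> \<in> space M. X b \<omega> < T})"
  define u where "u = (\<lambda>T b. \<integral>\<omega>. max 0 (X b \<omega> - T) \<partial>M)"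
  define v where "v = (\<lambda>T b. \<integral>\<omega>. max 0 (T - X b \<omega>) \<partial>M)"
  define D where "D = (\<lambda>T b. \<integral>\<omega>. \<bar>X b \<omega> - T\<bar> \<partial>M)"
  have c: "0 \<le> c T b" "c T b \<le> 1" for T b by (simp_all add: c_def)
  have uv: "0 \<le> u T b" "0 \<le> v T b" for T b by (simp_all add: u_def v_def)
  have D: "D T b = u T b + v T b" if "b \<in> {1..n}" for T b
    using integral_pos_part_add_neg_part[OF int[OF that]] by (simp add: D_def u_def v_def)
  have alg: "real n * ?A T = (\<Sum>b\<in>{1..n}. (sum (c T) {1..n} - c T b) * u T b
      + (real n - 1 - sum (c T) {1..n} + c T b) * v T b)" for T
    unfolding c_def u_def v_def using expected_alg_eq[OF n X int unif ind] .
  have opt: "?O \<le> (\<Sum>b\<in>{1..n}. D T b)" for T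
    unfolding D_def by (rule expected_opt_le[OF int unif])
  have rv: "random_variable borel (X i)" if "i \<in> {1..n}" for i
    using int[OF that] by auto
  have no_atom: "prob {\<omega> \<in> space M. X i \<omega> = x} = 0" if "i \<in> {1..n}" for i x
    by (rule abs_continuous_prob_eq_0[OF rv ac]) (use that in auto)
  have D_pos: "D T b > 0" if "b \<in> {1..n}" for T b
    unfolding D_def by (rule integral_abs_diff_pos[OF int no_atom]) (use that in auto)
  consider "n \<ge> 3" | "n = 2" using n by linarith
  then show ?thesis
  proof cases
    case 1
    have "\<exists>T. (\<Sum>i\<in>{1..n}. c T i) = real n / 2"
      unfolding c_def using rv no_atom 1 by (intro exists_sum_prob_less) auto
    then obtain T where T: "sum (c T) {1..n} = real n / 2" by blast
    have "(\<Sum>b\<in>{1..n}. (real n / 2 - 1) * D T b) \<le> real n * ?A T"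
      unfolding alg T
    proof (rule sum_mono)
      fix b assume b: "b \<in> {1..n}"
      have "(real n / 2 - 1) * u T b \<le> (real n / 2 - c T b) * u T b"
        "(real n / 2 - 1) * v T b \<le> (real n - 1 - real n / 2 + c T b) * v T b"
        using c[of T b] uv[of T b] by (auto intro!: mult_right_mono)
      then show "(real n / 2 - 1) * D T b \<le> (real n / 2 - c T b) * u T b
          + (real n - 1 - real n / 2 + c T b) * v T b"
        unfolding D[OF b] by (simp add: algebra_simps)
    qed
    then have le: "(real n / 2 - 1) * sum (D T) {1..n} \<le> real n * ?A T"
      by (simp add: sum_distrib_left)
    have "0 < sum (D T) {1..n}"
      using D_pos 1 by (intro sum_pos) auto
    then have "0 < (real n / 2 - 1) * sum (D T) {1..n}"
      using 1 by simp
    then have pos: "?A T > 0"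
      using le n by (metis less_le_trans of_nat_0_le_iff zero_less_mult_pos not_less mult_nonneg_nonpos)
    have "(real n / 2 - 1) * ?O \<le> (real n / 2 - 1) * sum (D T) {1..n}"
      using opt[of T] 1 by (intro mult_left_mono) auto
    also have "\<dots> \<le> real n * ?A T" by (rule le)
    \<comment> \<open>The constant 6 comes from
      \<open>(n - 2) * (1 + 6 / n) = n + 4 - 12 / n\<close>, which is at least \<open>n\<close> as
      soon as \<open>n \<ge> 3\<close>.\<close>
    also have "\<dots> \<le> (real n / 2 - 1) * ((1 + 6 / real n) * 2) * ?A T"
      using 1 pos by (intro mult_right_mono) (auto simp: field_simps)
    finally have "?O \<le> (1 + 6 / real n) * 2 * ?A T"
      using 1 by (simp add: mult.assoc)
    with pos show ?thesis by blast
  next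
    case 2
    have I: "{1..n} = {1, 2}" using 2 by auto
    have med: "\<exists>T. c T i = 1/2" if "i \<in> {1..n}" for i
      using exists_sum_prob_less[of "{i}" X "1/2"] rv no_atom that by (auto simp: c_def)
    obtain m where m: "c m 1 = 1/2" using med[of 1] 2 by auto
    obtain m' where m': "c m' 2 = 1/2" using med[of 2] 2 by auto
    have half: "D T j \<le> 4 * ?A T" if ij: "{1..n} = {i, j}" "i \<noteq> j" and T: "c T i = 1/2" for i j T
    proof -
      define p q where "p = c T j * u T i" and "q = (1 - c T j) * v T i"
      have "4 * ?A T = 2 * p + 2 * q + (u T j + v T j)"
        using alg[of T] ij(2) 2 unfolding ij(1) p_def q_def by (simp add: T field_simps)
      moreover have "0 \<le> p" "0 \<le> q"
        using c uv by (auto simp: p_def q_def)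
      moreover have "D T j = u T j + v T j"
        using D[of j T] unfolding ij(1) by simp
      ultimately show ?thesis by linarith
    qed
    have A: "D m 2 \<le> 4 * ?A m" and A': "D m' 1 \<le> 4 * ?A m'"
      using half[of 1 2 m] half[of 2 1 m'] m m' I by (simp_all add: insert_commute)
    \<comment> \<open>The bound on \<open>?O\<close> at \<open>m'\<close> contains
      \<open>D m' 2\<close>, whereas \<open>A\<close> controls \<open>D m 2\<close>; as
      \<open>m'\<close> is a median of \<open>X 2\<close>, the former is the smaller one.\<close>
    have "D m' 2 \<le> D m 2"
      unfolding D_def using m' int 2 by (intro median_minimizes_abs_diff) (simp_all add: c_def)
    with A A' opt[of m'] have O: "?O \<le> 4 * ?A m + 4 * ?A m'"
      using I by simp
    have "?A m > 0" "?A m' > 0"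
      using A A' D_pos[of 2 m] D_pos[of 1 m'] 2 by auto
    \<comment> \<open>For \<open>n = 2\<close> the claimed factor \<open>(1 + 6 / n) * 2\<close>
      equals 8, so the larger of the two expected profits suffices.\<close>
    moreover have "?O \<le> 8 * ?A m \<or> ?O \<le> 8 * ?A m'"
      using O by linarith
    ultimately show ?thesis using 2 by auto
  qed
qed

end

theorem theorem3:
  "\<exists>C::real. \<forall>n\<ge>2. \<forall>(M :: 'a measure) (X :: nat \<Rightarrow> 'a \<Rightarrow> real) (\<sigma> :: 'a \<Rightarrow> nat \<Rightarrow> nat).
     prob_space M \<longrightarrow>
     prob_space.indep_vars M (\<lambda>_. borel) X {1..n} \<longrightarrow>
     (\<forall>i\<in>{1..n}. absolutely_continuous lborel (distr M borel (X i))) \<longrightarrow>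
     (\<forall>i\<in>{1..n}. integrable M (X i)) \<longrightarrow>
     uniform_random_perm M n \<sigma> \<longrightarrow>
     perm_indep_of_prices M n X \<sigma> \<longrightarrow>
     (\<exists>T::real. expected_alg M n X \<sigma> T > 0 \<and>
        (1 + C / real n) * 2 \<ge> expected_opt M n X \<sigma> / expected_alg M n X \<sigma> T)"
proof (rule exI[of _ 6], intro allI impI)
  fix n :: nat and M :: "'a measure" and X :: "nat \<Rightarrow> 'a \<Rightarrow> real" and \<sigma> :: "'a \<Rightarrow> nat \<Rightarrow> nat"
  assume "2 \<le> n" and "prob_space M"
    and hyps: "prob_space.indep_vars M (\<lambda>_. borel) X {1..n}"
      "\<forall>i\<in>{1..n}. absolutely_continuous lborel (distr M borel (X i))"
      "\<forall>i\<in>{1..n}. integrable M (X i)" "uniform_random_perm M n \<sigma>" "perm_indep_of_prices M n X \<sigma>"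
  then interpret prob_space M by simp
  obtain T where "expected_alg M n X \<sigma> T > 0"
    "expected_opt M n X \<sigma> \<le> (1 + 6 / real n) * 2 * expected_alg M n X \<sigma> T"
    using exists_threshold[of n X \<sigma>] \<open>2 \<le> n\<close> hyps by blast
  then show "\<exists>T. expected_alg M n X \<sigma> T > 0 \<and>
      expected_opt M n X \<sigma> / expected_alg M n X \<sigma> T \<le> (1 + 6 / real n) * 2"
    by (intro exI[of _ T]) (simp add: pos_divide_le_eq)
qed

end
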